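(* Let $1<\delta<2$. Let $g\in C^2(0,1]$ satisfy $|g''(x)|\le Cx^{-\theta}$ for $0<x\le 1$, where $C$ and $\theta$ are some fixed constants with $0<\theta<1$. Let $b,c\in C[0,1]$ with $c(x)\ge 0$ for all $x\in(0,1)$. Let $\alpha_0,\alpha_1$ be real constants with $\alpha_0\ge \frac{1}{\delta-1}$ and $\alpha_1\ge 0$. Assume that $$-D_*^\delta g(x)+b(x)g'(x)+c(x)g(x)\ge 0\quad\text{for all }x\in(0,1),$$ $$g(0)-\alpha_0g'(0)\ge 0\quad\text{and}\quad g(1)+\alpha_1g'(1)\ge 0.$$ Then $g\ge 0$ on $[0,1]$.
   Context: Any $g\in C^2(0,1]$ with $|g''(x)|\le Cx^{-\theta}$ on $(0,1]$, $0<\theta<1$, extends to a function (also called $g$) in $C^1[0,1]$ with $g'$ absolutely continuous on $[0,1]$; $g(0)$ and $g'(0)$ refer to this extension. For $1<\delta<2$, the Caputo fractional derivative is $D_*^\delta g = D^\delta[g-T_1[g;0]]$, where $T_1[g;0](x)=g(0)+g'(0)x$ is the degree-1 Taylor polynomial of $g$ at $0$ and $D^\delta$ is the Riemann-Liouville derivative $$D^\delta w(x)=\left(\frac{d}{dx}\right)^2\left[\frac{1}{\Gamma(2-\delta)}\int_0^x(x-t)^{1-\delta}w(t)\,dt\right],\quad 0<x\le 1.$$ If $g\in C^1[0,1]$ and $g'$ is absolutely continuous on $[0,1]$ then equivalently $D_*^\delta g(x)=\frac{1}{\Gamma(2-\delta)}\int_0^x(x-t)^{1-\delta}g''(t)\,dt$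 for $0<x\le1$. *)

theory Defs
  imports "HOL-Analysis.Analysis"
begin

text \<open>Derivatives are taken within the domain of the function, so they are one-sided at its
  endpoints.\<close>

definition deriv_on :: "real set \<Rightarrow> (real \<Rightarrow> real) \<Rightarrow> real \<Rightarrow> real" where
  "deriv_on S f x = vector_derivative f (at x within S)"

definition C2_on :: "real set \<Rightarrow> (real \<Rightarrow> real) \<Rightarrow> bool" where
  "C2_on S f \<longleftrightarrow>
     (\<forall>x\<in>S. f differentiable (at x within S)) \<and>
     (\<forall>x\<in>S. deriv_on S f differentiable (at x within S)) \<and>
     continuous_on S (deriv_on S (deriv_on S f))"

text \<open>The extension to \<open>[0,1]\<close> of a function given on \<open>(0,1]\<close>. The value of \<open>f\<close> at \<open>0\<close> is
  ignored; if \<open>f\<close> has no limit at \<open>0\<close>, the new value is unspecified. The limit exists when \<open>f\<close> is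
  \<open>C\<^sup>2\<close> on \<open>(0,1]\<close> with \<open>\<bar>f''(x)\<bar> \<le> C x powr (-\<theta>)\<close> and \<open>\<theta> < 1\<close>, and the extension is then
  \<open>C\<^sup>1\<close> on \<open>[0,1]\<close>.\<close>

definition extend0 :: "(real \<Rightarrow> real) \<Rightarrow> real \<Rightarrow> real" where
  "extend0 f x = (if x = 0 then Lim (at_right 0) f else f x)"

text \<open>The Riemann-Liouville derivative of order \<open>\<delta>\<close> with \<open>1 < \<delta> < 2\<close>, at \<open>0 < x \<le> 1\<close>. The
  integrand takes the value \<open>0\<close> at its singularity \<open>t = s\<close>, since \<open>0 powr a = 0\<close>.\<close>

definition RL_deriv :: "real \<Rightarrow> (real \<Rightarrow> real) \<Rightarrow> real \<Rightarrow> real" where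
  "RL_deriv \<delta> w =
     deriv_on {0<..1} (deriv_on {0<..1}
       (\<lambda>s. 1 / Gamma (2 - \<delta>) * (LBINT t:{0..s}. (s - t) powr (1 - \<delta>) * w t)))"

definition taylor1 :: "(real \<Rightarrow> real) \<Rightarrow> real \<Rightarrow> real" where
  "taylor1 f x = f 0 + deriv_on {0..1} f 0 * x"

definition Caputo_deriv :: "real \<Rightarrow> (real \<Rightarrow> real) \<Rightarrow> real \<Rightarrow> real" where
  "Caputo_deriv \<delta> f = RL_deriv \<delta> (\<lambda>x. f x - taylor1 f x)"

end

theory Submission
  imports Defs
begin

text \<open>The theorem is a minimum principle. Write \<open>G\<close> for the extension of \<open>g\<close> to \<open>[0,1]\<close>
  and let \<open>G\<close> attain its minimum over \<open>[0,1]\<close> at \<open>x\<close>; suppose \<open>G x < 0\<close>. At \<open>x = 0\<close>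
  the derivative is nonnegative and at \<open>x = 1\<close> it is nonpositive, and each contradicts the boundary
  condition there. At an interior minimum the first order term vanishes and the zeroth order term is
  nonpositive, so it suffices that the Caputo derivative is positive.

  The Caputo derivative is nonlocal, so positivity is not a second derivative test. It comes from
  integrating by parts twice in the representation as a weakly singular integral
  (\<open>Caputo_deriv_eq_integral\<close>): at a critical point \<open>x\<close>, and up to the positive factor
  \<open>1 / Gamma (2 - \<delta>)\<close>,
  \[D_*^\delta G(x) = x^{-\delta} \big((\delta-1)(G(0)-G(x)) - x\,G'(0)\big)
     + \delta(\delta-1) \int_0^x (x-t)^{-\delta-1} (G(t)-G(x))\,dt.\]
  At a minimum the last integral is nonnegative, which leaves a lower bound in terms of boundary data
  (\<open>abel_integral_ge_at_minimum\<close>). The condition at \<open>0\<close> with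
  \<open>\<alpha>0 \<ge> 1 / (\<delta> - 1)\<close> is what makes this bound strictly positive: if \<open>G' 0 > 0\<close> then
  \<open>(\<delta> - 1) * G 0 \<ge> G' 0 > x * G' 0\<close> while \<open>- (\<delta> - 1) * G x > 0\<close>, and if
  \<open>G' 0 \<le> 0\<close> both \<open>(\<delta> - 1) * (G 0 - G x)\<close> and \<open>- x * G' 0\<close> are nonnegative and
  they cannot vanish together, because \<open>G' 0 = 0\<close> forces
  \<open>G 0 \<ge> 0 > G x\<close>.

  The Caputo derivative is given as the second derivative of a Riemann-Liouville integral, and the
  analytic work lies in moving both derivatives onto \<open>G\<close>. The kernel \<open>(s - t) powr a\<close> is
  singular at the moving endpoint, so one cannot differentiate in \<open>s\<close> directly. The substitution
  \<open>t = s * u\<close> turns the Abel integral into \<open>s powr (a + 1)\<close> times an integral over the fixed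
  interval \<open>[0,1]\<close> in which \<open>s\<close> occurs only inside the smooth factor; dominated convergence and
  one integration by parts then show that differentiating the Abel integral of a function vanishing at
  \<open>0\<close> gives the Abel integral of its derivative (\<open>abel_integral_has_derivative\<close>). Subtracting
  the Taylor polynomial makes this applicable twice.\<close>

section \<open>Abel integrals and their scaling\<close>

lemma continuous_on_Icc_abs_bound:
  fixes f :: "real \<Rightarrow> real"
  assumes "continuous_on {p..q} f"
  obtains B where "\<And>x. x \<in> {p..q} \<Longrightarrow> \<bar>f x\<bar> \<le> B"
proof -
  have "bounded (f ` {p..q})"
    using compact_imp_bounded[OF compact_continuous_image[OF assms compact_Icc]] .
  then obtain B where "\<forall>y\<in>f ` {p..q}. norm y \<le> B" unfolding bounded_iff by blast
  then show thesis by (intro that[of B]) auto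
qed

text \<open>The singularities at the two ends of \<open>[0,1]\<close> are separated, so the integrand is dominated
  by a multiple of a Beta integrand.\<close>
lemma weighted_stretch_absolutely_integrable:
  fixes f :: "real \<Rightarrow> real"
  assumes a: "a > -1" and \<theta>: "\<theta> < 1"
    and cont: "continuous_on {0<..1} f"
    and bnd: "\<And>x. 0 < x \<Longrightarrow> x \<le> 1 \<Longrightarrow> \<bar>f x\<bar> \<le> C * x powr (- \<theta>)"
    and s: "0 < s" "s \<le> 1"
  shows "(\<lambda>u. (1 - u) powr a * f (s * u)) absolutely_integrable_on {0..1}"
proof -
  have su: "0 < s * u \<and> s * u \<le> 1" if "0 < u" "u < 1" for u
    using s that mult_mono[of s 1 u 1] by auto
  have "continuous_on {0<..<1} (\<lambda>u. (1 - u) powr a * f (s * u))"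
    by (intro continuous_intros continuous_on_compose2[OF cont]) (use su in auto)
  then have meas: "(\<lambda>u. (1 - u) powr a * f (s * u)) \<in> borel_measurable (lebesgue_on {0<..<1})"
    by (intro continuous_imp_measurable_on_sets_lebesgue) auto
  have "(\<lambda>u. (C * s powr (- \<theta>)) * (u powr ((1 - \<theta>) - 1) * (1 - u) powr ((a + 1) - 1))) integrable_on {0..1}"
    by (intro integrable_on_mult_right integrable_Beta') (use a \<theta> in auto)
  then have int: "(\<lambda>u. (C * s powr (- \<theta>)) * (u powr (- \<theta>) * (1 - u) powr a)) integrable_on {0<..<1}"
    by (subst (asm) integrable_on_Icc_iff_Ioo) simp
  have "(\<lambda>u. (1 - u) powr a * f (s * u)) absolutely_integrable_on {0<..<1}"
  proof (rule measurable_bounded_by_integrable_imp_absolutely_integrable[OF meas _ int])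
    fix u :: real assume u: "u \<in> {0<..<1}"
    have "\<bar>f (s * u)\<bar> \<le> C * (s powr (- \<theta>) * u powr (- \<theta>))"
      using bnd[of "s * u"] su[of u] u s by (simp add: powr_mult)
    then have "(1 - u) powr a * \<bar>f (s * u)\<bar> \<le> (1 - u) powr a * (C * (s powr (- \<theta>) * u powr (- \<theta>)))"
      by (intro mult_left_mono) auto
    then show "norm ((1 - u) powr a * f (s * u)) \<le> (C * s powr (- \<theta>)) * (u powr (- \<theta>) * (1 - u) powr a)"
      by (simp add: abs_mult mult_ac)
  qed auto
  then show ?thesis
    using absolutely_integrable_on_Icc_iff_Ioo by blast
qed

lemma weighted_stretch_integrable:
  fixes w :: "real \<Rightarrow> real"
  assumes "a > -1" and cont: "continuous_on {0..1} w" and "0 < s" "s \<le> 1"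
  shows "(\<lambda>u. (1 - u) powr a * w (s * u)) integrable_on {0..1}"
proof -
  obtain M where M: "\<And>x. x \<in> {0..1} \<Longrightarrow> \<bar>w x\<bar> \<le> M"
    using continuous_on_Icc_abs_bound[OF cont] by metis
  have cont': "continuous_on {0<..1} w"
    by (rule continuous_on_subset[OF cont]) auto
  have "\<bar>w x\<bar> \<le> M * x powr (- 0)" if "0 < x" "x \<le> 1" for x
    using M[of x] that by simp
  from weighted_stretch_absolutely_integrable[OF assms(1) _ cont' this assms(3,4)]
  show ?thesis by (intro set_lebesgue_integral_eq_integral(1)) simp
qed

lemma divide_image_Icc: "0 < s \<Longrightarrow> (\<lambda>x. x / s) ` {0..s} = {0..1::real}"
  by (simp add: image_divide_atLeastAtMost)

text \<open>The substitution \<open>t = s * u\<close> pins the singularity of the kernel at \<open>u = 1\<close>, independently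
  of \<open>s\<close>.\<close>
lemma abel_integral_stretch:
  fixes f :: "real \<Rightarrow> real"
  assumes "0 < s"
  shows "integral {0..s} (\<lambda>t. (s - t) powr a * f t)
           = s powr (a + 1) * integral {0..1} (\<lambda>u. (1 - u) powr a * f (s * u))"
    and "(\<lambda>t. (s - t) powr a * f t) integrable_on {0..s}
           \<longleftrightarrow> (\<lambda>u. (1 - u) powr a * f (s * u)) integrable_on {0..1}"
proof -
  have ne: "s \<noteq> 0" using assms by simp
  have eq: "(s - s * u) powr a * f (s * u) = s powr a * ((1 - u) powr a * f (s * u))"
    if "u \<in> {0..1}" for u
  proof -
    have "s - s * u = s * (1 - u)" by (simp add: algebra_simps)
    then show ?thesis using assms that by (simp add: powr_mult)
  qed
  have "1 / s * integral {0..s} (\<lambda>t. (s - t) powr a * f t)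
          = integral {0..1} (\<lambda>u. (s - s * u) powr a * f (s * u))"
    using integral_stretch_real[OF ne, of 0 s "\<lambda>t. (s - t) powr a * f t"] assms
    by (simp add: divide_image_Icc)
  also have "\<dots> = integral {0..1} (\<lambda>u. s powr a * ((1 - u) powr a * f (s * u)))"
    by (rule integral_cong) (rule eq)
  also have "\<dots> = s powr a * integral {0..1} (\<lambda>u. (1 - u) powr a * f (s * u))"
    by simp
  finally show "integral {0..s} (\<lambda>t. (s - t) powr a * f t)
           = s powr (a + 1) * integral {0..1} (\<lambda>u. (1 - u) powr a * f (s * u))"
    using assms by (simp add: powr_add field_simps)
  have "(\<lambda>t. (s - t) powr a * f t) integrable_on {0..s}
          \<longleftrightarrow> (\<lambda>u. (s - s * u) powr a * f (s * u)) integrable_on {0..1}"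
    using integrable_stretch_real_iff[OF ne, of "\<lambda>t. (s - t) powr a * f t" 0 s] assms
    by (simp add: divide_image_Icc)
  also have "\<dots> \<longleftrightarrow> (\<lambda>u. s powr a * ((1 - u) powr a * f (s * u))) integrable_on {0..1}"
    by (rule integrable_cong) (rule eq)
  also have "\<dots> \<longleftrightarrow> (\<lambda>u. (1 - u) powr a * f (s * u)) integrable_on {0..1}"
    using assms by (simp add: integrable_on_cmult_iff)
  finally show "(\<lambda>t. (s - t) powr a * f t) integrable_on {0..s}
           \<longleftrightarrow> (\<lambda>u. (1 - u) powr a * f (s * u)) integrable_on {0..1}" .
qed

text \<open>Riemann-Liouville derivatives are defined with Lebesgue integrals, whereas scaling, dominated
  convergence and the fundamental theorem of calculus with singular endpoints are convenient for
  gauge integrals; this lemma connects the two.\<close>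
lemma abel_lebesgue_eq_integral:
  fixes w :: "real \<Rightarrow> real"
  assumes a: "a > -1" and s: "0 < s" "s \<le> 1" and cont: "continuous_on {0..1} w"
  shows "(LBINT t:{0..s}. (s - t) powr a * w t) = integral {0..s} (\<lambda>t. (s - t) powr a * w t)"
proof -
  have conts: "continuous_on {0..s} w"
    using cont by (rule continuous_on_subset) (use s in auto)
  have meas: "(\<lambda>t. indicator {0..s} t *\<^sub>R ((s - t) powr a * w t)) \<in> borel_measurable borel"
  proof -
    have "(\<lambda>t. indicator {0..s} t *\<^sub>R w t) \<in> borel_measurable borel"
      using conts by (intro borel_measurable_continuous_on_indicator) auto
    then have "(\<lambda>t. (s - t) powr a * (indicator {0..s} t *\<^sub>R w t)) \<in> borel_measurable borel"
      by measurable
    then show ?thesis by (simp add: mult_ac)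
  qed
  obtain B where B: "\<And>t. t \<in> {0..s} \<Longrightarrow> \<bar>w t\<bar> \<le> B"
    using continuous_on_Icc_abs_bound[OF conts] by metis
  have "(\<lambda>t. (s - t) powr a * B) integrable_on {0..s}"
    using weighted_stretch_integrable[OF a _ s, of "\<lambda>_. B"]
    by (subst abel_integral_stretch(2)[OF s(1), of a "\<lambda>_. B"]) auto
  moreover have "(\<lambda>t. (s - t) powr a * w t) \<in> borel_measurable (lebesgue_on {0..s})"
  proof -
    have "(\<lambda>t. indicator {0..s} t *\<^sub>R ((s - t) powr a * w t)) \<in> borel_measurable lborel"
      using meas by simp
    then have "(\<lambda>t. indicator {0..s} t *\<^sub>R ((s - t) powr a * w t)) \<in> borel_measurable (lebesgue_on {0..s})"
      by (intro measurable_restrict_space1 measurable_completion)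
    then show ?thesis
      by (rule measurable_cong[THEN iffD1, rotated]) (simp add: space_restrict_space)
  qed
  ultimately have "(\<lambda>t. (s - t) powr a * w t) absolutely_integrable_on {0..s}"
    by (intro measurable_bounded_by_integrable_imp_absolutely_integrable
          [where g = "\<lambda>t. (s - t) powr a * B"])
       (use B in \<open>auto simp: abs_mult intro!: mult_left_mono\<close>)
  then have "set_integrable lborel {0..s} (\<lambda>t. (s - t) powr a * w t)"
    unfolding set_integrable_def using meas by (subst (asm) integrable_completion) auto
  then show ?thesis
    by (rule set_borel_integral_eq_integral(2))
qed

section \<open>Differentiating an Abel integral\<close>

text \<open>A chain rule relative to \<open>(0,1]\<close>, which includes the one-sided derivative at
  \<open>s * u = 1\<close>.\<close>
lemma stretch_has_derivative:
  fixes w :: "real \<Rightarrow> real"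
  assumes der: "\<And>x. 0 < x \<Longrightarrow> x \<le> 1 \<Longrightarrow> (w has_real_derivative w' x) (at x within {0<..1})"
    and u: "0 < u" "u \<le> 1" and s: "0 < s" "s \<le> 1"
  shows "((\<lambda>y. w (y * u)) has_real_derivative u * w' (s * u)) (at s within {0<..1})"
proof -
  have su: "0 < s * u" "s * u \<le> 1" using u s mult_mono[of s 1 u 1] by auto
  have "y * u \<le> 1" if "0 < y" "y \<le> 1" for y
    using mult_mono[of y 1 u 1] that u by simp
  then have "(\<lambda>y. y * u) ` {0<..1} \<subseteq> {0<..1}" using u by auto
  from has_field_derivative_subset[OF der[OF su] this]
  have "(w has_real_derivative w' (s * u)) (at (s * u) within (\<lambda>y. y * u) ` {0<..1})" .
  moreover have "((\<lambda>y. y * u) has_real_derivative u) (at s within {0<..1})"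
    by (auto intro!: derivative_eq_intros)
  ultimately have "(w \<circ> (\<lambda>y. y * u) has_real_derivative w' (s * u) * u) (at s within {0<..1})"
    by (rule DERIV_image_chain)
  then show ?thesis by (simp add: o_def mult.commute)
qed

text \<open>Differentiation under the integral sign. For \<open>y > s / 2\<close> the mean value theorem bounds the
  difference quotients of \<open>y \<mapsto> w (y * u)\<close> by \<open>C * u * (s * u / 2) powr (-\<theta>)\<close>: the factor
  \<open>u\<close> from the chain rule absorbs the singularity of \<open>w'\<close> at \<open>0\<close>, so the quotients are
  bounded uniformly in \<open>u\<close>, and the kernel dominates.\<close>
lemma weighted_stretch_has_derivative:
  fixes w w' :: "real \<Rightarrow> real"
  assumes a: "a > -1" and \<theta>: "0 \<le> \<theta>" "\<theta> < 1"
    and cont: "continuous_on {0..1} w"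
    and der: "\<And>x. 0 < x \<Longrightarrow> x \<le> 1 \<Longrightarrow> (w has_real_derivative w' x) (at x within {0<..1})"
    and bnd: "\<And>x. 0 < x \<Longrightarrow> x \<le> 1 \<Longrightarrow> \<bar>w' x\<bar> \<le> C * x powr (- \<theta>)"
    and s: "0 < s" "s \<le> 1"
  shows "(\<lambda>u. (1 - u) powr a * (u * w' (s * u))) integrable_on {0..1}"
    and "((\<lambda>y. integral {0..1} (\<lambda>u. (1 - u) powr a * w (y * u))) has_real_derivative
            integral {0..1} (\<lambda>u. (1 - u) powr a * (u * w' (s * u)))) (at s within {0<..1})"
proof -
  have C0: "0 \<le> C" using bnd[of 1] by simp
  define B where "B = C * (s / 2) powr (- \<theta>)"
  have B0: "0 \<le> B" using C0 by (simp add: B_def)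
  note intw = weighted_stretch_integrable[OF a cont]
  have intB: "(\<lambda>u. (1 - u) powr a * B) integrable_on {0..1}"
    using weighted_stretch_integrable[OF a, of "\<lambda>_. B" 1] by auto
  have lip: "\<bar>w (y * u) - w (s * u)\<bar> \<le> B * \<bar>y - s\<bar>"
    if u: "0 \<le> u" "u \<le> 1" and y: "s / 2 < y" "y \<le> 1" for u y
  proof (cases "u = 0")
    case False
    with u have u0: "0 < u" by simp
    define l where "l = s / 2 * u"
    have l0: "0 < l" using s u0 by (simp add: l_def)
    have "\<bar>w (y * u) - w (s * u)\<bar> \<le> (C * l powr (- \<theta>)) * norm (y * u - s * u)"
      unfolding real_norm_def[symmetric, of "w _ - w _"]
    proof (rule field_differentiable_bound[where S = "{l..1}" and f' = w'])
      show "(w has_real_derivative w' z) (at z within {l..1})" if "z \<in> {l..1}" for z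
        using der[of z] that l0 by (auto intro: has_field_derivative_subset)
      show "norm (w' z) \<le> C * l powr (- \<theta>)" if z: "z \<in> {l..1}" for z
      proof -
        have "z powr (- \<theta>) \<le> l powr (- \<theta>)"
          using z l0 \<theta> by (intro powr_mono2') auto
        then show ?thesis
          using bnd[of z] z l0 C0 mult_left_mono[of "z powr (- \<theta>)" "l powr (- \<theta>)" C] by auto
      qed
      show "y * u \<in> {l..1}" "s * u \<in> {l..1}"
        using u0 u y s mult_mono[of y 1 u 1] mult_mono[of s 1 u 1] by (auto simp: l_def)
    qed simp
    also have "norm (y * u - s * u) = u * \<bar>y - s\<bar>"
      using u0 by (simp add: left_diff_distrib[symmetric] abs_mult)
    also have "(C * l powr (- \<theta>)) * (u * \<bar>y - s\<bar>) = (B * \<bar>y - s\<bar>) * u powr (1 - \<theta>)"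
    proof -
      have "l powr (- \<theta>) * u = (s / 2) powr (- \<theta>) * u powr (1 - \<theta>)"
        unfolding l_def powr_mult using u0 powr_add[of u "- \<theta>" 1] by simp
      then show ?thesis by (simp add: B_def mult_ac)
    qed
    also have "\<dots> \<le> (B * \<bar>y - s\<bar>) * 1"
      using u0 u \<theta> B0 by (intro mult_left_mono powr_le1) auto
    finally show ?thesis by simp
  qed (use B0 in simp)
  (* Along any sequence tending to s, dominated convergence gives integrability of the pointwise
     limit together with the convergence of the integrals. *)
  have main: "(\<lambda>u. (1 - u) powr a * (u * w' (s * u))) integrable_on {0..1} \<and>
      (\<lambda>n. (integral {0..1} (\<lambda>u. (1 - u) powr a * w (X n * u))
               - integral {0..1} (\<lambda>u. (1 - u) powr a * w (s * u))) / (X n - s))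
        \<longlonglongrightarrow> integral {0..1} (\<lambda>u. (1 - u) powr a * (u * w' (s * u)))"
    if X: "\<And>n. X n \<in> {s/2<..1} - {s}" and lim: "X \<longlonglongrightarrow> s" for X
  proof -
    define q where "q n u = (1 - u) powr a * ((w (X n * u) - w (s * u)) / (X n - s))" for n u
    have X': "0 < X n" "X n \<le> 1" "X n \<noteq> s" "s / 2 < X n" for n using X[of n] s by auto
    have qeq: "q n = (\<lambda>u. ((1 - u) powr a * w (X n * u) - (1 - u) powr a * w (s * u)) / (X n - s))" for n
      by (rule ext) (simp add: q_def algebra_simps diff_divide_distrib)
    have qint: "(q n has_integral (integral {0..1} (\<lambda>u. (1 - u) powr a * w (X n * u))
               - integral {0..1} (\<lambda>u. (1 - u) powr a * w (s * u))) / (X n - s)) {0..1}" for n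
      unfolding qeq using intw X' s
      by (intro has_integral_divide has_integral_diff integrable_integral) auto
    have qbound: "norm (q n u) \<le> (1 - u) powr a * B" if "u \<in> {0..1}" for n u
    proof -
      have "\<bar>w (X n * u) - w (s * u)\<bar> / \<bar>X n - s\<bar> \<le> B"
        using lip[of u "X n"] that X'[of n] by (subst pos_divide_le_eq) auto
      then show ?thesis
        unfolding q_def real_norm_def abs_mult abs_divide by (intro mult_mono) auto
    qed
    have qlim: "(\<lambda>n. q n u) \<longlonglongrightarrow> (1 - u) powr a * (u * w' (s * u))" if u: "u \<in> {0..1}" for u
    proof (cases "u = 0")
      case False
      with u have "((\<lambda>y. w (y * u)) has_real_derivative u * w' (s * u)) (at s within {0<..1})"
        by (intro stretch_has_derivative der s) auto
      then have "((\<lambda>y. (w (y * u) - w (s * u)) / (y - s)) \<longlongrightarrow> u * w' (s * u)) (at s within {0<..1})"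
        by (simp add: has_field_derivative_iff)
      then have "(\<lambda>n. (w (X n * u) - w (s * u)) / (X n - s)) \<longlonglongrightarrow> u * w' (s * u)"
        using X' lim by (auto simp: tendsto_at_iff_sequentially o_def)
      then show ?thesis unfolding q_def by (rule tendsto_mult_left)
    qed (simp add: q_def)
    have qi: "\<And>n. q n integrable_on {0..1}" using qint by (auto simp: integrable_on_def)
    show ?thesis
      using dominated_convergence[OF qi intB qbound qlim] integral_unique[OF qint] by simp
  qed
  (* Integrability does not mention a sequence, so one sequence has to be exhibited; the shift by two
     keeps it strictly above s/2. *)
  have "(\<lambda>n. s - s / 2 * inverse (real (Suc (Suc n)))) \<longlonglongrightarrow> s - s / 2 * 0"
    by (intro tendsto_intros LIMSEQ_Suc[OF LIMSEQ_inverse_real_of_nat])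
  then have seq: "(\<lambda>n. s - s / 2 * inverse (real (Suc (Suc n)))) \<longlonglongrightarrow> s" by simp
  have "s - s / 2 * inverse (real (Suc (Suc n))) \<in> {s/2<..1} - {s}" for n
  proof -
    define r where "r = s / 2 * inverse (real (Suc (Suc n)))"
    have "0 < r" using s by (simp add: r_def)
    moreover have "r < s / 2"
      using s mult_strict_left_mono[of "inverse (real (Suc (Suc n)))" 1 "s / 2"]
      by (simp add: r_def inverse_less_1_iff)
    ultimately show ?thesis unfolding r_def[symmetric] using s by auto
  qed
  from main[OF this seq]
  show "(\<lambda>u. (1 - u) powr a * (u * w' (s * u))) integrable_on {0..1}" by blast
  have eq: "at s within {0<..1} = at s within {s/2<..1}"
    by (rule at_within_nhd[of _ "{s/2<..}"]) (use s in auto)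
  show "((\<lambda>y. integral {0..1} (\<lambda>u. (1 - u) powr a * w (y * u))) has_real_derivative
            integral {0..1} (\<lambda>u. (1 - u) powr a * (u * w' (s * u)))) (at s within {0<..1})"
    unfolding eq has_field_derivative_iff tendsto_at_iff_sequentially o_def using main by blast
qed

lemma powr_diff_has_derivative:
  fixes t x r :: real
  assumes "t < x"
  shows "((\<lambda>t. (x - t) powr r) has_real_derivative - (r * (x - t) powr (r - 1))) (at t)"
  using assms by (auto intro!: derivative_eq_intros)

text \<open>With \<open>K s\<close> the integral of \<open>(1 - u) powr a * w (s * u)\<close> over \<open>[0,1]\<close>, the Abel
  integral is \<open>s powr (a + 1) * K s\<close>, and the product rule leaves a term \<open>(a + 1) * K s\<close>. Since
  \<open>(a + 1) * (1 - u) powr a\<close> is minus the derivative of \<open>(1 - u) powr (a + 1)\<close>, integration by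
  parts turns that term into an integral of \<open>w'\<close>. There is no boundary contribution: the power
  vanishes at \<open>u = 1\<close> and \<open>w 0 = 0\<close> takes care of \<open>u = 0\<close>. The weights \<open>u\<close> and
  \<open>1 - u\<close> of the two resulting integrals add up to one.\<close>
lemma abel_integral_has_derivative:
  fixes w w' :: "real \<Rightarrow> real"
  assumes a: "a > -1" and \<theta>: "0 \<le> \<theta>" "\<theta> < 1"
    and cont: "continuous_on {0..1} w" and w0: "w 0 = 0"
    and der: "\<And>x. 0 < x \<Longrightarrow> x \<le> 1 \<Longrightarrow> (w has_real_derivative w' x) (at x within {0<..1})"
    and bnd: "\<And>x. 0 < x \<Longrightarrow> x \<le> 1 \<Longrightarrow> \<bar>w' x\<bar> \<le> C * x powr (- \<theta>)"
    and s: "0 < s" "s \<le> 1"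
  shows "((\<lambda>y. integral {0..y} (\<lambda>t. (y - t) powr a * w t)) has_real_derivative
            integral {0..s} (\<lambda>t. (s - t) powr a * w' t)) (at s within {0<..1})"
proof -
  define K where "K y = integral {0..1} (\<lambda>u. (1 - u) powr a * w (y * u))" for y
  define K1 where "K1 = integral {0..1} (\<lambda>u. (1 - u) powr a * (u * w' (s * u)))"
  have K1: "((\<lambda>u. (1 - u) powr a * (u * w' (s * u))) has_integral K1) {0..1}"
    unfolding K1_def
    using weighted_stretch_has_derivative(1)[OF a \<theta> cont der bnd s] by (rule integrable_integral)
  have Kder: "(K has_real_derivative K1) (at s within {0<..1})"
    unfolding K_def[abs_def] K1_def
    by (rule weighted_stretch_has_derivative(2)[OF a \<theta> cont der bnd s])
  have K: "((\<lambda>u. (1 - u) powr a * w (s * u)) has_integral K s) {0..1}"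
    unfolding K_def by (rule integrable_integral weighted_stretch_integrable[OF a cont s])+
  let ?\<phi> = "\<lambda>u. (1 - u) powr (a + 1) * w (s * u)"
  have parts: "((\<lambda>u. (1 - u) powr (a + 1) * (s * w' (s * u)) - (a + 1) * ((1 - u) powr a * w (s * u)))
          has_integral (?\<phi> 1 - ?\<phi> 0)) {0..1}"
  proof (rule fundamental_theorem_of_calculus_interior)
    show "continuous_on {0..1} ?\<phi>"
      by (intro continuous_intros continuous_on_powr' continuous_on_compose2[OF cont])
         (use a s mult_mono[of s 1 _ 1] in auto)
    fix u :: real assume u: "u \<in> {0<..<1}"
    have "s * u \<le> 1 * u" using u s by (intro mult_right_mono) auto
    also have "1 * u < 1" using u by simp
    finally have su: "0 < s * u" "s * u < 1" using u s by auto
    have "(w has_real_derivative w' (s * u)) (at (s * u))"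
    proof -
      have "(w has_real_derivative w' (s * u)) (at (s * u) within {0<..<1})"
        by (rule has_field_derivative_subset[OF der]) (use su in auto)
      then show ?thesis using su by (simp add: at_within_open[of _ "{0<..<1}"])
    qed
    then have "((\<lambda>u. w (s * u)) has_real_derivative w' (s * u) * s) (at u)"
      by (rule DERIV_chain2) (auto intro!: derivative_eq_intros)
    moreover have "((\<lambda>u. (1 - u) powr (a + 1)) has_real_derivative - ((a + 1) * (1 - u) powr a)) (at u)"
      using powr_diff_has_derivative[of u 1 "a + 1"] u by simp
    ultimately have "(?\<phi> has_real_derivative
        - ((a + 1) * (1 - u) powr a) * w (s * u) + (w' (s * u) * s) * (1 - u) powr (a + 1)) (at u)"
      by (rule DERIV_mult[rotated])
    then show "(?\<phi> has_vector_derivative (1 - u) powr (a + 1) * (s * w' (s * u))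
        - (a + 1) * ((1 - u) powr a * w (s * u))) (at u)"
      by (simp add: has_real_derivative_iff_has_vector_derivative[symmetric] mult_ac)
  qed simp
  have "((\<lambda>u. s * ((1 - u) powr a * (u * w' (s * u)))
      + ((1 - u) powr (a + 1) * (s * w' (s * u)) - (a + 1) * ((1 - u) powr a * w (s * u)))
      + (a + 1) * ((1 - u) powr a * w (s * u)))
      has_integral s * K1 + (?\<phi> 1 - ?\<phi> 0) + (a + 1) * K s) {0..1}"
    by (intro has_integral_add has_integral_mult_right K K1 parts)
  then have "((\<lambda>u. s * ((1 - u) powr a * w' (s * u))) has_integral s * K1 + (a + 1) * K s) {0..1}"
  proof (rule has_integral_eq_rhs[OF has_integral_eq[rotated]])
    fix u :: real assume "u \<in> {0..1}"
    then have shift: "(1 - u) powr (a + 1) = (1 - u) powr a * (1 - u)"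
      by (cases "u = 1") (auto simp: powr_add)
    show "s * ((1 - u) powr a * (u * w' (s * u)))
      + ((1 - u) powr (a + 1) * (s * w' (s * u)) - (a + 1) * ((1 - u) powr a * w (s * u)))
      + (a + 1) * ((1 - u) powr a * w (s * u)) = s * ((1 - u) powr a * w' (s * u))"
      unfolding shift by (simp add: algebra_simps)
  qed (use w0 in simp)
  then have eq: "s * integral {0..1} (\<lambda>u. (1 - u) powr a * w' (s * u)) = s * K1 + (a + 1) * K s"
    by (simp add: integral_unique flip: integral_mult_right)
  have "((\<lambda>y. y powr (a + 1) * K y) has_real_derivative
      ((a + 1) * s powr a) * K s + K1 * s powr (a + 1)) (at s within {0<..1})"
  proof (rule DERIV_mult[OF _ Kder])
    have "((\<lambda>y. y powr (a + 1)) has_real_derivative (a + 1) * s powr a) (at s)"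
      using has_real_derivative_powr[OF s(1), of "a + 1"] by simp
    then show "((\<lambda>y. y powr (a + 1)) has_real_derivative (a + 1) * s powr a) (at s within {0<..1})"
      by (rule has_field_derivative_at_within)
  qed
  also have "((a + 1) * s powr a) * K s + K1 * s powr (a + 1)
      = s powr a * (s * integral {0..1} (\<lambda>u. (1 - u) powr a * w' (s * u)))"
    unfolding eq using s by (simp add: powr_add algebra_simps)
  also have "\<dots> = integral {0..s} (\<lambda>t. (s - t) powr a * w' t)"
    unfolding abel_integral_stretch(1)[OF s(1)] using s by (simp add: powr_add)
  finally show ?thesis
  proof (rule has_field_derivative_transform_within[of _ _ _ _ 1])
    show "y powr (a + 1) * K y = integral {0..y} (\<lambda>t. (y - t) powr a * w t)"
      if "y \<in> {0<..1}" for y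
      unfolding K_def by (rule abel_integral_stretch(1)[symmetric]) (use that in auto)
  qed (use s in auto)
qed

section \<open>The Caputo derivative as a weakly singular integral\<close>
lemma deriv_on_eq:
  assumes "(f has_real_derivative D) (at x within S)" "x islimpt S"
  shows "deriv_on S f x = D"
  unfolding deriv_on_def using assms
  by (intro vector_derivative_within)
     (auto simp: has_real_derivative_iff_has_vector_derivative trivial_limit_within)

lemma islimpt_Ioc_01: "0 < x \<Longrightarrow> x \<le> 1 \<Longrightarrow> x islimpt {0<..1::real}"
  using islimpt_greaterThanLessThan2[of 0 x] by (rule islimpt_subset) auto

text \<open>The function \<open>w = G - T\<^sub>1[G;0]\<close> and its derivative both vanish at \<open>0\<close>, so
  \<open>abel_integral_has_derivative\<close> applies twice: first to \<open>w\<close>, whose derivative is bounded,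
  then to \<open>w'\<close>, whose derivative has the singularity \<open>x powr (-\<theta>)\<close>.\<close>
lemma Caputo_deriv_eq_integral:
  fixes G G1 G2 :: "real \<Rightarrow> real"
  assumes \<delta>: "1 < \<delta>" "\<delta> < 2" and \<theta>: "0 \<le> \<theta>" "\<theta> < 1"
    and der1: "\<And>x. 0 \<le> x \<Longrightarrow> x \<le> 1 \<Longrightarrow> (G has_real_derivative G1 x) (at x within {0..1})"
    and cont1: "continuous_on {0..1} G1"
    and der2: "\<And>x. 0 < x \<Longrightarrow> x \<le> 1 \<Longrightarrow> (G1 has_real_derivative G2 x) (at x within {0<..1})"
    and bnd: "\<And>x. 0 < x \<Longrightarrow> x \<le> 1 \<Longrightarrow> \<bar>G2 x\<bar> \<le> C * x powr (- \<theta>)"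
    and x: "0 < x" "x \<le> 1"
  shows "Caputo_deriv \<delta> G x = 1 / Gamma (2 - \<delta>) * integral {0..x} (\<lambda>t. (x - t) powr (1 - \<delta>) * G2 t)"
proof -
  define a where "a = 1 - \<delta>"
  have a: "a > -1" using \<delta> by (simp add: a_def)
  let ?c = "1 / Gamma (2 - \<delta>)"
  have d0: "deriv_on {0..1} G 0 = G1 0"
    by (rule deriv_on_eq[OF der1]) auto
  define w where "w x = G x - taylor1 G x" for x
  define w1 where "w1 x = G1 x - G1 0" for x
  have wder: "(w has_real_derivative w1 x) (at x within {0..1})" if "0 \<le> x" "x \<le> 1" for x
    unfolding w_def[abs_def] w1_def taylor1_def d0
    by (auto intro!: derivative_eq_intros der1 that)
  have wcont: "continuous_on {0..1} w"
    using wder by (auto intro!: DERIV_continuous_on)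
  have w1cont: "continuous_on {0..1} w1"
    unfolding w1_def[abs_def] by (intro continuous_intros cont1)
  have wder': "(w has_real_derivative w1 x) (at x within {0<..1})" if "0 < x" "x \<le> 1" for x
    using wder[of x] that by (auto intro: has_field_derivative_subset)
  have w1der: "(w1 has_real_derivative G2 x) (at x within {0<..1})" if "0 < x" "x \<le> 1" for x
    unfolding w1_def[abs_def] using der2[OF that] by (auto intro!: derivative_eq_intros)
  obtain M where M: "\<And>x. x \<in> {0..1} \<Longrightarrow> \<bar>w1 x\<bar> \<le> M"
    using continuous_on_Icc_abs_bound[OF w1cont] by metis
  let ?J = "\<lambda>f y. integral {0..y} (\<lambda>t. (y - t) powr a * f t)"
  have inner: "((\<lambda>y. ?c * (LBINT t:{0..y}. (y - t) powr a * w t)) has_real_derivative ?c * ?J w1 s)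
      (at s within {0<..1})" if s: "0 < s" "s \<le> 1" for s
  proof -
    (* The bound M on w1 serves as M * x powr 0. *)
    have "(?J w has_real_derivative ?J w1 s) (at s within {0<..1})"
      by (rule abel_integral_has_derivative[OF a, of 0 w w1 M])
         (use s M wcont wder' in \<open>auto simp: w_def taylor1_def\<close>)
    then have "((\<lambda>y. ?c * ?J w y) has_real_derivative ?c * ?J w1 s) (at s within {0<..1})"
      by (rule DERIV_cmult)
    then show ?thesis
      by (rule has_field_derivative_transform_within[of _ _ _ _ 1])
         (use s a wcont in \<open>auto simp: abel_lebesgue_eq_integral\<close>)
  qed
  have innereq: "deriv_on {0<..1} (\<lambda>y. ?c * (LBINT t:{0..y}. (y - t) powr a * w t)) s = ?c * ?J w1 s"
    if "0 < s" "s \<le> 1" for s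
    using that by (intro deriv_on_eq inner islimpt_Ioc_01)
  have "(?J w1 has_real_derivative ?J G2 x) (at x within {0<..1})"
    by (rule abel_integral_has_derivative[OF a \<theta>])
       (use x bnd w1cont w1der in \<open>auto simp: w1_def[of 0]\<close>)
  then have "((\<lambda>y. ?c * ?J w1 y) has_real_derivative ?c * ?J G2 x) (at x within {0<..1})"
    by (rule DERIV_cmult)
  then have "(deriv_on {0<..1} (\<lambda>y. ?c * (LBINT t:{0..y}. (y - t) powr a * w t))
      has_real_derivative ?c * ?J G2 x) (at x within {0<..1})"
  proof (rule has_field_derivative_transform_within[of _ _ _ _ 1])
    show "?c * ?J w1 y = deriv_on {0<..1} (\<lambda>y. ?c * (LBINT t:{0..y}. (y - t) powr a * w t)) y"
      if "y \<in> {0<..1}" for y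
      using that by (intro innereq[symmetric]) auto
  qed (use x in auto)
  then have "RL_deriv \<delta> w x = ?c * ?J G2 x"
    unfolding RL_deriv_def a_def[symmetric] using x by (intro deriv_on_eq islimpt_Ioc_01)
  then show ?thesis
    unfolding Caputo_deriv_def w_def[abs_def] a_def .
qed

section \<open>A lower bound at an interior minimum\<close>

text \<open>Two integrations by parts in one step: \<open>F\<close> collects the boundary terms of both, and its
  derivative is \<open>(x - t) powr (1 - \<delta>) * G2 t\<close> minus a multiple of the nonnegative
  \<open>(x - t) powr (-\<delta> - 1) * (G t - G x)\<close>. Hence the Abel integral is at least \<open>F x - F 0\<close>.
  Working with \<open>F\<close> avoids treating the strongly singular integral on its own. The
  singularity of \<open>F\<close> at \<open>t = x\<close> is removable because \<open>x\<close> is a critical point near which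
  \<open>G2\<close> is bounded: \<open>G1 t\<close> is of order \<open>x - t\<close> and \<open>G t - G x\<close> of order
  \<open>(x - t)\<^sup>2\<close>, so \<open>F t\<close> is of order \<open>(x - t) powr (2 - \<delta>)\<close>.\<close>
lemma abel_integral_ge_at_minimum:
  fixes G G1 G2 :: "real \<Rightarrow> real"
  assumes \<delta>: "1 < \<delta>" "\<delta> < 2" and \<theta>: "\<theta> < 1"
    and der1: "\<And>x. 0 \<le> x \<Longrightarrow> x \<le> 1 \<Longrightarrow> (G has_real_derivative G1 x) (at x within {0..1})"
    and cont1: "continuous_on {0..1} G1"
    and der2: "\<And>x. 0 < x \<Longrightarrow> x \<le> 1 \<Longrightarrow> (G1 has_real_derivative G2 x) (at x within {0<..1})"
    and cont2: "continuous_on {0<..1} G2"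
    and bnd: "\<And>x. 0 < x \<Longrightarrow> x \<le> 1 \<Longrightarrow> \<bar>G2 x\<bar> \<le> C * x powr (- \<theta>)"
    and x: "0 < x" "x < 1"
    and min: "\<And>y. 0 \<le> y \<Longrightarrow> y \<le> 1 \<Longrightarrow> G x \<le> G y" and crit: "G1 x = 0"
  shows "integral {0..x} (\<lambda>t. (x - t) powr (1 - \<delta>) * G2 t)
           \<ge> x powr (- \<delta>) * ((\<delta> - 1) * (G 0 - G x) - x * G1 0)"
proof -
  define F where "F t = (x - t) powr (1 - \<delta>) * G1 t - (\<delta> - 1) * ((x - t) powr (- \<delta>) * (G t - G x))" for t
  define F' where "F' t = (x - t) powr (1 - \<delta>) * G2 t
      - (\<delta> - 1) * \<delta> * ((x - t) powr (- \<delta> - 1) * (G t - G x))" for t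
  have Gcont: "continuous_on {0..1} G" using der1 by (auto intro!: DERIV_continuous_on)
  have "continuous_on {x/2..x} G2" using x by (intro continuous_on_subset[OF cont2]) auto
  then obtain M where M: "\<And>t. t \<in> {x/2..x} \<Longrightarrow> \<bar>G2 t\<bar> \<le> M"
    using continuous_on_Icc_abs_bound by metis
  have M0: "0 \<le> M" using M[of x] x by auto
  have G1b: "\<bar>G1 t\<bar> \<le> M * (x - t)" if t: "x / 2 \<le> t" "t \<le> x" for t
  proof -
    have "norm (G1 t - G1 x) \<le> M * norm (t - x)"
      by (rule field_differentiable_bound[where S = "{x/2..x}" and f' = G2])
         (use x t M in \<open>auto intro!: has_field_derivative_subset[OF der2]\<close>)
    then show ?thesis using t crit by simp
  qed
  have Gb: "\<bar>G t - G x\<bar> \<le> M * (x - t) * (x - t)" if t: "x / 2 \<le> t" "t \<le> x" for t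
  proof -
    have "norm (G t - G x) \<le> (M * (x - t)) * norm (t - x)"
    proof (rule field_differentiable_bound[where S = "{t..x}" and f' = G1])
      show "norm (G1 z) \<le> M * (x - t)" if "z \<in> {t..x}" for z
        using G1b[of z] that t M0 mult_left_mono[of "x - z" "x - t" M] by auto
    qed (use x t in \<open>auto intro!: has_field_derivative_subset[OF der1]\<close>)
    then show ?thesis using t by simp
  qed
  have Fb: "\<bar>F t\<bar> \<le> M * \<delta> * (x - t) powr (2 - \<delta>)" if t: "x / 2 \<le> t" "t \<le> x" for t
  proof (cases "t = x")
    case False
    with t have p: "0 < x - t" by simp
    have p1: "(x - t) powr (1 - \<delta>) * (x - t) = (x - t) powr (2 - \<delta>)"
      using p powr_add[of "x - t" "1 - \<delta>" 1] by simp
    have p2: "(x - t) powr (- \<delta>) * ((x - t) * (x - t)) = (x - t) powr (2 - \<delta>)"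
      using p powr_add[of "x - t" "- \<delta>" 2] by (simp add: powr_numeral power2_eq_square)
    have "\<bar>F t\<bar> \<le> (x - t) powr (1 - \<delta>) * \<bar>G1 t\<bar> + (\<delta> - 1) * ((x - t) powr (- \<delta>) * \<bar>G t - G x\<bar>)"
      unfolding F_def using \<delta> by (intro order.trans[OF abs_triangle_ineq4]) (simp add: abs_mult)
    also have "\<dots> \<le> (x - t) powr (1 - \<delta>) * (M * (x - t))
        + (\<delta> - 1) * ((x - t) powr (- \<delta>) * (M * (x - t) * (x - t)))"
      using \<delta> G1b[OF t] Gb[OF t] by (intro add_mono mult_left_mono) auto
    also have "\<dots> = M * ((x - t) powr (1 - \<delta>) * (x - t))
        + (\<delta> - 1) * M * ((x - t) powr (- \<delta>) * ((x - t) * (x - t)))"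
      by (simp add: mult_ac)
    also have "\<dots> = M * \<delta> * (x - t) powr (2 - \<delta>)"
      unfolding p1 p2 by (simp add: algebra_simps)
    finally show ?thesis .
  qed (simp add: F_def)
  (* The limit of F at x; since 0 powr r = 0, the formula for F already takes this value. *)
  have Fx: "F x = 0" by (simp add: F_def)
  have "continuous_on {0..x} F"
    unfolding continuous_on_eq_continuous_within
  proof
    fix t assume t: "t \<in> {0..x}"
    show "continuous (at t within {0..x}) F"
    proof (cases "t = x")
      case True
      have lim: "((\<lambda>t. M * \<delta> * (x - t) powr (2 - \<delta>)) \<longlongrightarrow> 0) (at x within {0..x})"
      proof -
        have "continuous_on {0..x} (\<lambda>t. M * \<delta> * (x - t) powr (2 - \<delta>))"
          using \<delta> by (intro continuous_intros continuous_on_powr') auto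
        then show ?thesis using x by (auto simp: continuous_on_def dest: bspec[of _ _ x])
      qed
      have "eventually (\<lambda>t. t \<in> {x/2<..}) (at x within {0..x})"
        using x by (intro eventually_at_topological[THEN iffD2] exI[of _ "{x/2<..}"]) auto
      then have "eventually (\<lambda>t. norm (F t) \<le> M * \<delta> * (x - t) powr (2 - \<delta>)) (at x within {0..x})"
        by (auto simp: eventually_at_filter elim!: eventually_mono intro!: Fb)
      then have "(F \<longlongrightarrow> 0) (at x within {0..x})"
        by (rule Lim_null_comparison[OF _ lim])
      then show ?thesis by (simp add: True continuous_within Fx)
    next
      case False
      with t have t': "0 \<le> t" "t < x" by auto
      have c1: "continuous (at t within {0..x}) G" "continuous (at t within {0..x}) G1"
        using t' x continuous_on_subset[OF Gcont, of "{0..x}"] continuous_on_subset[OF cont1, of "{0..x}"]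
        by (auto simp: continuous_on_eq_continuous_within)
      show ?thesis unfolding F_def[abs_def]
        by (intro continuous_intros c1) (use t' in auto)
    qed
  qed
  moreover have "(F has_vector_derivative F' t) (at t)" if t: "t \<in> {0<..<x}" for t
  proof -
    have "(G has_real_derivative G1 t) (at t within {0<..<1})"
         "(G1 has_real_derivative G2 t) (at t within {0<..<1})"
      using t x by (auto intro!: has_field_derivative_subset[OF der1] has_field_derivative_subset[OF der2])
    then have d: "(G has_real_derivative G1 t) (at t)" "(G1 has_real_derivative G2 t) (at t)"
      using t x by (auto simp: at_within_open[of t "{0<..<1}"])
    have p: "((\<lambda>t. (x - t) powr r) has_real_derivative - (r * (x - t) powr (r - 1))) (at t)" for r
      using t by (intro powr_diff_has_derivative) auto
    have "(F has_real_derivative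
         (- ((1 - \<delta>) * (x - t) powr (1 - \<delta> - 1)) * G1 t + G2 t * (x - t) powr (1 - \<delta>))
         - (\<delta> - 1) * (- (- \<delta> * (x - t) powr (- \<delta> - 1)) * (G t - G x) + (G1 t - 0) * (x - t) powr (- \<delta>)))
         (at t)"
      unfolding F_def[abs_def]
      by (intro DERIV_diff DERIV_mult DERIV_cmult p d DERIV_const)
    also have "(- ((1 - \<delta>) * (x - t) powr (1 - \<delta> - 1)) * G1 t + G2 t * (x - t) powr (1 - \<delta>))
         - (\<delta> - 1) * (- (- \<delta> * (x - t) powr (- \<delta> - 1)) * (G t - G x) + (G1 t - 0) * (x - t) powr (- \<delta>))
         = F' t"
      by (simp add: F'_def algebra_simps)
    finally show ?thesis by (simp add: has_real_derivative_iff_has_vector_derivative)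
  qed
  ultimately have "(F' has_integral (F x - F 0)) {0..x}"
    using x by (intro fundamental_theorem_of_calculus_interior) auto
  moreover have "((\<lambda>t. (x - t) powr (1 - \<delta>) * G2 t) has_integral
      integral {0..x} (\<lambda>t. (x - t) powr (1 - \<delta>) * G2 t)) {0..x}"
  proof (rule integrable_integral)
    have "(\<lambda>u. (1 - u) powr (1 - \<delta>) * G2 (x * u)) absolutely_integrable_on {0..1}"
      by (rule weighted_stretch_absolutely_integrable[OF _ \<theta> cont2 bnd]) (use x \<delta> in auto)
    then show "(\<lambda>t. (x - t) powr (1 - \<delta>) * G2 t) integrable_on {0..x}"
      unfolding abel_integral_stretch(2)[OF x(1)] by (rule set_lebesgue_integral_eq_integral(1))
  qed
  ultimately have "F x - F 0 \<le> integral {0..x} (\<lambda>t. (x - t) powr (1 - \<delta>) * G2 t)"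
  proof (rule has_integral_le)
    fix t assume "t \<in> {0..x}"
    then have "0 \<le> (\<delta> - 1) * \<delta> * ((x - t) powr (- \<delta> - 1) * (G t - G x))"
      using \<delta> min[of t] x by (intro mult_nonneg_nonneg) auto
    then show "F' t \<le> (x - t) powr (1 - \<delta>) * G2 t" by (simp add: F'_def)
  qed
  moreover have "F x - F 0 = x powr (- \<delta>) * ((\<delta> - 1) * (G 0 - G x) - x * G1 0)"
  proof -
    have "x powr (1 - \<delta>) = x powr (- \<delta>) * x" using x powr_add[of x "- \<delta>" 1] by simp
    then show ?thesis by (simp add: Fx) (simp add: F_def algebra_simps)
  qed
  ultimately show ?thesis by simp
qed

section \<open>The extension to the closed interval\<close>

text \<open>Since \<open>x powr (-\<theta>)\<close> is integrable, so is \<open>g''\<close>. Integrating it back from \<open>1\<close>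
  gives a continuous \<open>G1\<close> on \<open>[0,1]\<close> that agrees with \<open>g'\<close> on \<open>(0,1]\<close>, and integrating
  \<open>G1\<close> gives a \<open>C\<^sup>1\<close> function that agrees with \<open>g\<close> there. Its value at \<open>0\<close> must be the
  limit of \<open>g\<close>.\<close>
lemma extend0_C1:
  fixes g :: "real \<Rightarrow> real"
  assumes C2: "C2_on {0<..1} g" and \<theta>: "\<theta> < 1"
    and bnd: "\<And>x. 0 < x \<Longrightarrow> x \<le> 1 \<Longrightarrow>
           \<bar>deriv_on {0<..1} (deriv_on {0<..1} g) x\<bar> \<le> C * x powr (- \<theta>)"
  obtains G1 where
    "\<And>x. 0 \<le> x \<Longrightarrow> x \<le> 1 \<Longrightarrow> (extend0 g has_real_derivative G1 x) (at x within {0..1})"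
    "continuous_on {0..1} G1"
    "\<And>x. 0 < x \<Longrightarrow> x \<le> 1 \<Longrightarrow>
        (G1 has_real_derivative deriv_on {0<..1} (deriv_on {0<..1} g) x) (at x within {0<..1})"
proof -
  define g1 where "g1 = deriv_on {0<..1} g"
  define g2 where "g2 = deriv_on {0<..1} g1"
  have d1: "(g has_real_derivative g1 x) (at x within {0<..1})" if "0 < x" "x \<le> 1" for x
    using C2 that unfolding C2_on_def g1_def deriv_on_def
    by (auto simp: has_real_derivative_iff_has_vector_derivative vector_derivative_works[symmetric])
  have d2: "(g1 has_real_derivative g2 x) (at x within {0<..1})" if "0 < x" "x \<le> 1" for x
    using C2 that unfolding C2_on_def g1_def g2_def deriv_on_def
    by (auto simp: has_real_derivative_iff_has_vector_derivative vector_derivative_works[symmetric])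
  have c2: "continuous_on {0<..1} g2" using C2 by (simp add: C2_on_def g1_def g2_def)
  have bnd': "\<bar>g2 x\<bar> \<le> C * x powr (- \<theta>)" if "0 < x" "x \<le> 1" for x
    using bnd[OF that] by (simp add: g1_def g2_def)
  (* The case a = 0, s = 1 of the weighted lemma; its weight 0 powr 0 = 0 at u = 1 is a null set
     exception. *)
  have int2: "g2 integrable_on {0..1}"
    using set_lebesgue_integral_eq_integral(1)
        [OF weighted_stretch_absolutely_integrable[OF _ \<theta> c2 bnd', of 0 1]]
    by (rule integrable_spike[of _ _ "{1}"]) auto
  define G1 where "G1 x = g1 1 - integral {x..1} g2" for x
  have G1c: "continuous_on {0..1} G1"
    unfolding G1_def[abs_def] by (intro continuous_intros indefinite_integral_continuous_1' int2)
  have ftc: "integral {x..1} f' = f 1 - f x"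
    if x: "0 < x" "x \<le> 1"
      and d: "\<And>x. 0 < x \<Longrightarrow> x \<le> 1 \<Longrightarrow> (f has_real_derivative f' x) (at x within {0<..1})"
    for f f' :: "real \<Rightarrow> real" and x
    by (rule integral_unique, rule fundamental_theorem_of_calculus)
       (use x in \<open>auto simp: has_real_derivative_iff_has_vector_derivative[symmetric]
                    intro!: has_field_derivative_subset[OF d]\<close>)
  have G1eq: "G1 x = g1 x" if "0 < x" "x \<le> 1" for x
    using ftc[OF that d2] by (simp add: G1_def)
  define G where "G x = g 1 - integral {x..1} G1" for x
  have Gder: "(G has_real_derivative G1 x) (at x within {0..1})" if "0 \<le> x" "x \<le> 1" for x
    unfolding G_def[abs_def] using that G1c
    by (auto intro!: derivative_eq_intros integral_has_real_derivative')
  have Geq: "G x = g x" if x: "0 < x" "x \<le> 1" for x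
  proof -
    have "integral {x..1} G1 = integral {x..1} g1"
      by (rule integral_cong) (use x G1eq in auto)
    then show ?thesis using ftc[OF x d1] by (simp add: G_def)
  qed
  have "continuous_on {0..1} G" using Gder by (auto intro!: DERIV_continuous_on)
  then have "(G \<longlongrightarrow> G 0) (at_right 0)"
    by (auto simp: continuous_on_def at_within_Icc_at_right dest: bspec[of _ _ 0])
  moreover have "eventually (\<lambda>x. G x = g x) (at_right 0)"
    using eventually_at_right_real[OF zero_less_one] by eventually_elim (auto simp: Geq)
  ultimately have "(g \<longlongrightarrow> G 0) (at_right 0)"
    by (rule Lim_transform_eventually)
  then have "Lim (at_right 0) g = G 0"
    by (intro tendsto_Lim) auto
  then have ext: "extend0 g x = G x" if "0 \<le> x" "x \<le> 1" for x
    using that Geq[of x] by (auto simp: extend0_def)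
  show thesis
  proof (rule that[OF _ G1c])
    show "(extend0 g has_real_derivative G1 x) (at x within {0..1})" if "0 \<le> x" "x \<le> 1" for x
      by (rule has_field_derivative_transform_within[OF Gder[OF that], of 1]) (use that ext in auto)
    show "(G1 has_real_derivative deriv_on {0<..1} (deriv_on {0<..1} g) x) (at x within {0<..1})"
      if "0 < x" "x \<le> 1" for x
      using that unfolding g1_def[symmetric] g2_def[symmetric]
      by (intro has_field_derivative_transform_within[OF d2[OF that], of 1]) (auto simp: G1eq)
  qed
qed

section \<open>The comparison principle\<close>
theorem theorem2p1:
  fixes g b c :: "real \<Rightarrow> real" and \<delta> \<theta> C \<alpha>0 \<alpha>1 :: real
  assumes "1 < \<delta>" and "\<delta> < 2"
    and "C2_on {0<..1} g"
    and "0 < \<theta>" and "\<theta> < 1"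
    and "\<And>x. 0 < x \<Longrightarrow> x \<le> 1 \<Longrightarrow>
           \<bar>deriv_on {0<..1} (deriv_on {0<..1} g) x\<bar> \<le> C * x powr (- \<theta>)"
    and "continuous_on {0..1} b" and "continuous_on {0..1} c"
    and "\<And>x. 0 < x \<Longrightarrow> x < 1 \<Longrightarrow> c x \<ge> 0"
    and "\<alpha>0 \<ge> 1 / (\<delta> - 1)" and "\<alpha>1 \<ge> 0"
    and "\<And>x. 0 < x \<Longrightarrow> x < 1 \<Longrightarrow>
           - Caputo_deriv \<delta> (extend0 g) x + b x * deriv_on {0..1} (extend0 g) x
             + c x * extend0 g x \<ge> 0"
    and "extend0 g 0 - \<alpha>0 * deriv_on {0..1} (extend0 g) 0 \<ge> 0"
    and "extend0 g 1 + \<alpha>1 * deriv_on {0..1} (extend0 g) 1 \<ge> 0"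
  shows "\<forall>x\<in>{0..1}. extend0 g x \<ge> 0"
proof -
  note \<delta> = assms(1,2) and c0 = assms(9) and \<alpha>0 = assms(10) and \<alpha>1 = assms(11)
  define G where "G = extend0 g"
  define G2 where "G2 = deriv_on {0<..1} (deriv_on {0<..1} g)"
  have bnd: "\<bar>G2 x\<bar> \<le> C * x powr (- \<theta>)" if "0 < x" "x \<le> 1" for x
    using assms(6)[OF that] by (simp add: G2_def)
  have cont2: "continuous_on {0<..1} G2" using assms(3) by (simp add: C2_on_def G2_def)
  obtain G1 where
    der1: "\<And>x. 0 \<le> x \<Longrightarrow> x \<le> 1 \<Longrightarrow> (G has_real_derivative G1 x) (at x within {0..1})"
    and cont1: "continuous_on {0..1} G1"
    and der2: "\<And>x. 0 < x \<Longrightarrow> x \<le> 1 \<Longrightarrow> (G1 has_real_derivative G2 x) (at x within {0<..1})"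
    using extend0_C1[OF assms(3,5,6)] unfolding G_def G2_def by metis
  have dG: "deriv_on {0..1} G x = G1 x" if "0 \<le> x" "x \<le> 1" for x
    by (rule deriv_on_eq[OF der1[OF that]]) (use that in \<open>auto simp: islimpt_Icc\<close>)
  have bc0: "G 0 \<ge> \<alpha>0 * G1 0" using assms(13) dG[of 0] by (simp add: G_def)
  have bc1: "G 1 + \<alpha>1 * G1 1 \<ge> 0" using assms(14) dG[of 1] by (simp add: G_def)
  have \<alpha>0pos: "0 < \<alpha>0" using \<alpha>0 \<delta> by (intro less_le_trans[OF _ \<alpha>0]) auto
  have "continuous_on {0..1} G" using der1 by (auto intro!: DERIV_continuous_on)
  then obtain x where x: "0 \<le> x" "x \<le> 1" and min: "\<And>y. 0 \<le> y \<Longrightarrow> y \<le> 1 \<Longrightarrow> G x \<le> G y"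
    using continuous_attains_inf[of "{0..1::real}" G] by auto
  have "G x \<ge> 0"
  proof (rule ccontr)
    assume "\<not> G x \<ge> 0"
    then have neg: "G x < 0" by simp
    have right: "G1 x \<ge> 0" if "x < 1"
    proof -
      have "((\<lambda>y. (G y - G x) / (y - x)) \<longlongrightarrow> G1 x) (at x within {x..1})"
        using has_field_derivative_subset[OF der1[OF x], of "{x..1}"] x
        by (auto simp: has_field_derivative_iff)
      moreover have "eventually (\<lambda>y. (G y - G x) / (y - x) \<ge> 0) (at x within {x..1})"
        using min x by (auto simp: eventually_at_filter intro!: always_eventually divide_nonneg_nonneg)
      ultimately show ?thesis
        by (rule tendsto_lowerbound) (use that in \<open>simp add: trivial_limit_within islimpt_Icc\<close>)
    qed
    have left: "G1 x \<le> 0" if "0 < x"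
    proof -
      have "((\<lambda>y. (G y - G x) / (y - x)) \<longlongrightarrow> G1 x) (at x within {0..x})"
        using has_field_derivative_subset[OF der1[OF x], of "{0..x}"] x
        by (auto simp: has_field_derivative_iff)
      moreover have "eventually (\<lambda>y. (G y - G x) / (y - x) \<le> 0) (at x within {0..x})"
        using min x by (auto simp: eventually_at_filter intro!: always_eventually divide_nonneg_nonpos)
      ultimately show ?thesis
        by (rule tendsto_upperbound) (use that in \<open>simp add: trivial_limit_within islimpt_Icc\<close>)
    qed
    consider "x = 0" | "x = 1" | "0 < x" "x < 1" using x by linarith
    then show False
    proof cases
      case 1
      then have "0 \<le> \<alpha>0 * G1 0" using right \<alpha>0pos by simp
      then show False using bc0 neg 1 by simp
    next
      case 2
      then have "\<alpha>1 * G1 1 \<le> 0" using left \<alpha>1 by (simp add: mult_nonneg_nonpos)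
      then show False using bc1 neg 2 by simp
    next
      case 3
      then have crit: "G1 x = 0" using left right by simp
      (* Up to a positive factor, the lower bound on the Caputo derivative at the minimum. *)
      let ?E = "(\<delta> - 1) * (G 0 - G x) - x * G1 0"
      have "0 < ?E"
      proof (cases "0 < G1 0")
        case True
        have "G1 0 \<le> (\<delta> - 1) * \<alpha>0 * G1 0"
          using \<alpha>0 \<delta> True by (simp add: divide_le_eq mult.commute)
        also have "\<dots> \<le> (\<delta> - 1) * G 0" using bc0 \<delta> by (simp add: mult.assoc)
        finally have "G1 0 \<le> (\<delta> - 1) * G 0" .
        moreover have "x * G1 0 \<le> G1 0" using True x by simp
        moreover have "(\<delta> - 1) * G x < 0" using \<delta> neg by (simp add: mult_pos_neg)
        ultimately show ?thesis by (simp add: right_diff_distrib)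
      next
        case False
        have "0 \<le> (\<delta> - 1) * (G 0 - G x)" using \<delta> min[of 0] by simp
        moreover have "x * G1 0 \<le> 0" using False 3 by (simp add: mult_nonneg_nonpos)
        moreover have False if "G1 0 = 0" "G 0 = G x" using bc0 that neg by simp
        moreover have "0 < (\<delta> - 1) * (G 0 - G x)" if "G 0 \<noteq> G x"
          using \<delta> min[of 0] that by simp
        moreover have "x * G1 0 < 0" if "G1 0 \<noteq> 0" using False that 3 by (simp add: mult_pos_neg)
        ultimately show ?thesis by argo
      qed
      then have "0 < x powr (- \<delta>) * ?E" using 3 by simp
      also have "\<dots> \<le> integral {0..x} (\<lambda>t. (x - t) powr (1 - \<delta>) * G2 t)"
        by (rule abel_integral_ge_at_minimum[OF \<delta> assms(5) der1 cont1 der2 cont2 bnd 3 min crit])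
      finally have "0 < 1 / Gamma (2 - \<delta>) * integral {0..x} (\<lambda>t. (x - t) powr (1 - \<delta>) * G2 t)"
        using \<delta> by (intro mult_pos_pos) (auto intro: Gamma_real_pos)
      also have "\<dots> = Caputo_deriv \<delta> G x"
        using assms(4) by (intro Caputo_deriv_eq_integral[symmetric, OF \<delta> _ assms(5) der1 cont1 der2 bnd 3(1) x(2)]) auto
      finally have "0 < Caputo_deriv \<delta> G x" .
      moreover have "c x * G x \<le> 0" using c0[OF 3] neg by (simp add: mult_nonneg_nonpos)
      ultimately show False
        using assms(12)[OF 3] dG[OF x] crit by (simp add: G_def)
    qed
  qed
  then show ?thesis using min unfolding G_def by force
qed

end
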